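(* Let $(p_h^i,\phi_h)$ be the finite element solution on the fine grid, let $(p_H^i,\phi_H)$ be the finite element solution on the coarse grid, and let $(p_h^{i,*},\phi_h^* )$ be the fully decoupled two-grid solution on the fine grid ($i=1,2$), all as defined in the context. Suppose that $\phi_h\in W^{1,\infty}(\Omega)$ and $p_H^i\in L^\infty(\Omega)$. Then $$\|\nabla(p_h^i-p_h^{i,*})\|_{0,\Omega}\le C\left(\|p_h^i-p_H^i\|_{0,\Omega}+\|\nabla(\phi_h-\phi_H)\|_{0,\Omega}\right),$$ where $C$ denotes a positive constant independent of $h$.
   Context: Let $\Omega\subset\mathbb{R}^d$ ($d=2,3$) be a bounded Lipschitz domain, $(\cdot,\cdot)$ the $L^2(\Omega)$ inner product, and $\|\cdot\|_{0,\Omega}$ the $L^2(\Omega)$ norm. Let $q^1=1$, $q^2=-1$, and let $F_1,F_2,F_3$ be the given reaction source terms. Let $\Gamma_h$ be a quasi-uniform triangulation of $\Omega$ with mesh size $h>0$, and let $S_h(\Omega)=\{v\in H^1(\Omega): v|_{\partial\Omega}=0 \text{ and } v|_e \text{ is a linear polynomial for every } e\in\Gamma_h\}$. The coarse space $S_H(\Omega)$ is defined by replacing $h$ with $H$. Standing assumption: the weak steady-state Poisson-Nernst-Planck problem, find $p^1,p^2,\phi\in H_0^1(\Omega)$ with $(\nabla p^i,\nabla v)+(q^ip^i\nabla\phi,\nabla v)=(F_i,v)$ for all $v\in H_0^1(\Omega)$, $i=1,2$, and $(\nabla\phi,\nabla w)=\sum_{i=1}^2 q^i(p^i,w)+(F_3,w)$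 for all $w\in H_0^1(\Omega)$, has a unique solution, and so does its finite element approximation below. Finite element solution on the fine grid: $(p_h^1,p_h^2,\phi_h)\in[S_h(\Omega)]^3$ satisfies $$(\nabla p_h^i,\nabla v_h)+(q^ip_h^i\nabla\phi_h,\nabla v_h)=(F_i,v_h)\quad\forall v_h\in S_h(\Omega),\ i=1,2,$$ $$(\nabla\phi_h,\nabla w_h)=\sum_{i=1}^2q^i(p_h^i,w_h)+(F_3,w_h)\quad\forall w_h\in S_h(\Omega).$$ Finite element solution on the coarse grid: $(p_H^1,p_H^2,\phi_H)\in[S_H(\Omega)]^3$ satisfies the same system with $h$ replaced by $H$ throughout. Fully decoupled two-grid solution: $(p_h^{1,*},p_h^{2,*},\phi_h^* )\in[S_h(\Omega)]^3$ is determined by $$(\nabla p_h^{i,*},\nabla v_h)=(F_i,v_h)-(q^ip_H^i\nabla\phi_H,\nabla v_h)\quad\forall v_h\in S_h(\Omega),\ i=1,2,$$ $$(\nabla\phi_h^*,\nabla w_h)=\sum_{i=1}^2q^i(p_H^i,w_h)+(F_3,w_h)\quad\forall w_h\in S_h(\Omega).$$ *)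

theory Defs
  imports "HOL-Analysis.Analysis" "HOL-Probability.Essential_Supremum"
begin

subsection \<open>Domains\<close>

text \<open>
  Near every boundary point the domain is the strict epigraph, in some direction \<open>n\<close>, of a
  Lipschitz function on the hyperplane orthogonal to \<open>n\<close>; the point
  \<open>x - (x \<bullet> n) n\<close> is the orthogonal projection of \<open>x\<close> to that hyperplane.
\<close>

definition bounded_lipschitz_domain :: "'a::euclidean_space set \<Rightarrow> bool" where
  "bounded_lipschitz_domain \<Omega> \<longleftrightarrow>
     open \<Omega> \<and> connected \<Omega> \<and> bounded \<Omega> \<and> \<Omega> \<noteq> {} \<and>
     (\<forall>x0\<in>frontier \<Omega>. \<exists>r>0. \<exists>n L. \<exists>\<gamma> :: 'a \<Rightarrow> real.
        norm n = 1 \<and> L-lipschitz_on {y. y \<bullet> n = 0} \<gamma> \<and>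
        \<Omega> \<inter> ball x0 r = {x \<in> ball x0 r. x \<bullet> n > \<gamma> (x - (x \<bullet> n) *\<^sub>R n)})"

subsection \<open>Lebesgue and Sobolev spaces\<close>

text \<open>
  Elements of the spaces are functions, not classes of functions modulo null sets. Only the values
  on \<open>\<Omega>\<close> matter.
\<close>

definition L2 :: "'a::euclidean_space set \<Rightarrow> ('a \<Rightarrow> 'b::euclidean_space) set" where
  "L2 \<Omega> = {f. f \<in> borel_measurable (lebesgue_on \<Omega>) \<and>
                integrable (lebesgue_on \<Omega>) (\<lambda>x. (norm (f x))\<^sup>2)}"

definition L2_inner :: "'a::euclidean_space set \<Rightarrow> ('a \<Rightarrow> 'b::euclidean_space) \<Rightarrow> ('a \<Rightarrow> 'b) \<Rightarrow> real" where
  "L2_inner \<Omega> f g = (\<integral>x. f x \<bullet> g x \<partial>lebesgue_on \<Omega>)"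

definition L2_norm :: "'a::euclidean_space set \<Rightarrow> ('a \<Rightarrow> 'b::euclidean_space) \<Rightarrow> real" where
  "L2_norm \<Omega> f = sqrt (L2_inner \<Omega> f f)"

definition Linf_norm :: "'a::euclidean_space set \<Rightarrow> ('a \<Rightarrow> 'b::euclidean_space) \<Rightarrow> ereal" where
  "Linf_norm \<Omega> f = esssup (lebesgue_on \<Omega>) (\<lambda>x. ereal (norm (f x)))"

definition Linf :: "'a::euclidean_space set \<Rightarrow> ('a \<Rightarrow> 'b::euclidean_space) set" where
  "Linf \<Omega> = {f. f \<in> borel_measurable (lebesgue_on \<Omega>) \<and> Linf_norm \<Omega> f < \<infinity>}"

definition L1_loc :: "'a::euclidean_space set \<Rightarrow> ('a \<Rightarrow> 'b::euclidean_space) set" where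
  "L1_loc \<Omega> = {f. f \<in> borel_measurable (lebesgue_on \<Omega>) \<and>
                    (\<forall>K. compact K \<and> K \<subseteq> \<Omega> \<longrightarrow> integrable (lebesgue_on K) f)}"

text \<open>\<open>C_k k f\<close>: the function \<open>f\<close> is \<open>k\<close> times continuously differentiable on the whole space.\<close>

primrec C_k :: "nat \<Rightarrow> ('a::euclidean_space \<Rightarrow> real) \<Rightarrow> bool" where
  "C_k 0 f \<longleftrightarrow> continuous_on UNIV f"
| "C_k (Suc k) f \<longleftrightarrow> (\<forall>x. f differentiable (at x)) \<and>
                      (\<forall>b\<in>Basis. C_k k (\<lambda>x. frechet_derivative f (at x) b))"

text \<open>The space of smooth functions with compact support in \<open>\<Omega>\<close>.\<close>

definition test_functions :: "'a::euclidean_space set \<Rightarrow> ('a \<Rightarrow> real) set" where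
  "test_functions \<Omega> = {\<psi>. (\<forall>k. C_k k \<psi>) \<and>
                            (\<exists>K. compact K \<and> K \<subseteq> \<Omega> \<and> (\<forall>x. x \<notin> K \<longrightarrow> \<psi> x = 0))}"

definition has_weak_gradient ::
  "'a::euclidean_space set \<Rightarrow> ('a \<Rightarrow> real) \<Rightarrow> ('a \<Rightarrow> 'a) \<Rightarrow> bool" where
  "has_weak_gradient \<Omega> u g \<longleftrightarrow> u \<in> L1_loc \<Omega> \<and> g \<in> L1_loc \<Omega> \<and>
     (\<forall>\<psi>\<in>test_functions \<Omega>. \<forall>b\<in>Basis.
        (\<integral>x. u x * frechet_derivative \<psi> (at x) b \<partial>lebesgue_on \<Omega>) =
        - (\<integral>x. (g x \<bullet> b) * \<psi> x \<partial>lebesgue_on \<Omega>))"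

text \<open>
  On an open set the weak gradient is unique up to null sets. The choice of a
  representative does not affect the integrals and essential suprema below.
\<close>

definition wgrad :: "'a::euclidean_space set \<Rightarrow> ('a \<Rightarrow> real) \<Rightarrow> 'a \<Rightarrow> 'a" where
  "wgrad \<Omega> u = (SOME g. has_weak_gradient \<Omega> u g)"

definition H1 :: "'a::euclidean_space set \<Rightarrow> ('a \<Rightarrow> real) set" where
  "H1 \<Omega> = {u \<in> L2 \<Omega>. \<exists>g\<in>L2 \<Omega>. has_weak_gradient \<Omega> u g}"

definition H1_norm :: "'a::euclidean_space set \<Rightarrow> ('a \<Rightarrow> real) \<Rightarrow> real" where
  "H1_norm \<Omega> u = sqrt ((L2_norm \<Omega> u)\<^sup>2 + (L2_norm \<Omega> (wgrad \<Omega> u))\<^sup>2)"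

definition H1_0 :: "'a::euclidean_space set \<Rightarrow> ('a \<Rightarrow> real) set" where
  "H1_0 \<Omega> = {u \<in> H1 \<Omega>. \<forall>\<epsilon>>0. \<exists>\<psi>\<in>test_functions \<Omega>. H1_norm \<Omega> (\<lambda>x. u x - \<psi> x) < \<epsilon>}"

definition W1inf :: "'a::euclidean_space set \<Rightarrow> ('a \<Rightarrow> real) set" where
  "W1inf \<Omega> = {u \<in> Linf \<Omega>. \<exists>g\<in>Linf \<Omega>. has_weak_gradient \<Omega> u g}"

definition W1inf_norm :: "'a::euclidean_space set \<Rightarrow> ('a \<Rightarrow> real) \<Rightarrow> ereal" where
  "W1inf_norm \<Omega> u = max (Linf_norm \<Omega> u) (Linf_norm \<Omega> (wgrad \<Omega> u))"

subsection \<open>Triangulations and finite element spaces\<close>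

text \<open>
  The elements are closed nondegenerate simplices, and any two of them meet in a common
  (possibly empty) face.
\<close>

definition triangulation_of :: "'a::euclidean_space set \<Rightarrow> 'a set set \<Rightarrow> bool" where
  "triangulation_of \<Omega> \<T> \<longleftrightarrow>
     triangulation \<T> \<and> (\<forall>e\<in>\<T>. int DIM('a) simplex e) \<and> \<Union>\<T> = closure \<Omega>"

definition mesh_size :: "'a::euclidean_space set set \<Rightarrow> real" where
  "mesh_size \<T> = Max (diameter ` \<T>)"

text \<open>
  Quasi-uniformity is a property of the whole family: one constant \<open>\<kappa>\<close> serves all meshes, and
  every element of the mesh of size \<open>h\<close> contains a ball of radius \<open>\<kappa> h\<close>. This comprises
  shape regularity and comparability of all element diameters with \<open>h\<close>. The set \<open>J\<close> contains
  the mesh sizes that occur.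
\<close>

definition quasi_uniform_triangulations ::
  "'a::euclidean_space set \<Rightarrow> real set \<Rightarrow> (real \<Rightarrow> 'a set set) \<Rightarrow> bool" where
  "quasi_uniform_triangulations \<Omega> J \<Gamma> \<longleftrightarrow>
     (\<forall>h\<in>J. h > 0 \<and> triangulation_of \<Omega> (\<Gamma> h) \<and> mesh_size (\<Gamma> h) = h) \<and>
     (\<exists>\<kappa>>0. \<forall>h\<in>J. \<forall>e\<in>\<Gamma> h. \<exists>x. cball x (\<kappa> * h) \<subseteq> e)"

text \<open>
  Being affine on every closed element, \<open>v\<close> is the continuous representative on
  \<open>closure \<Omega>\<close>, so that its boundary values are meant pointwise.
\<close>

definition fe_space :: "'a::euclidean_space set \<Rightarrow> 'a set set \<Rightarrow> ('a \<Rightarrow> real) set" where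
  "fe_space \<Omega> \<T> = {v \<in> H1 \<Omega>. (\<forall>x\<in>frontier \<Omega>. v x = 0) \<and>
                               (\<forall>e\<in>\<T>. \<exists>a c. \<forall>x\<in>e. v x = a \<bullet> x + c)}"

subsection \<open>The Poisson--Nernst--Planck system\<close>

definition q :: "nat \<Rightarrow> real" where
  "q i = (if i = 1 then 1 else - 1)"

text \<open>
  The system in weak form, with trial and test space \<open>V\<close>: the continuous problem for
  \<open>V = H1_0 \<Omega>\<close> and its Galerkin approximation for \<open>V = fe_space \<Omega> \<T>\<close>. Species and
  equations are numbered from 1, so \<open>p\<close> matters at 1, 2 and \<open>F\<close> at 1, 2, 3.

  Since a divergent Bochner integral has the value 0, it must be required that the drift
  integral exists: for general functions of \<open>H1_0\<close> the product need not be integrable. For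
  finite element functions the requirement is always met.
\<close>

definition pnp_solution ::
  "'a::euclidean_space set \<Rightarrow> ('a \<Rightarrow> real) set \<Rightarrow> (nat \<Rightarrow> 'a \<Rightarrow> real) \<Rightarrow>
   (nat \<Rightarrow> 'a \<Rightarrow> real) \<Rightarrow> ('a \<Rightarrow> real) \<Rightarrow> bool" where
  "pnp_solution \<Omega> V F p \<phi> \<longleftrightarrow>
     (\<forall>i\<in>{1,2}. p i \<in> V) \<and> \<phi> \<in> V \<and>
     (\<forall>i\<in>{1,2}. \<forall>v\<in>V.
        integrable (lebesgue_on \<Omega>) (\<lambda>x. (q i * p i x) *\<^sub>R wgrad \<Omega> \<phi> x \<bullet> wgrad \<Omega> v x) \<and>
        L2_inner \<Omega> (wgrad \<Omega> (p i)) (wgrad \<Omega> v)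
          + L2_inner \<Omega> (\<lambda>x. (q i * p i x) *\<^sub>R wgrad \<Omega> \<phi> x) (wgrad \<Omega> v)
        = L2_inner \<Omega> (F i) v) \<and>
     (\<forall>w\<in>V. L2_inner \<Omega> (wgrad \<Omega> \<phi>) (wgrad \<Omega> w)
        = (\<Sum>i\<in>{1,2}. q i * L2_inner \<Omega> (p i) w) + L2_inner \<Omega> (F 3) w)"

definition pnp_uniquely_solvable ::
  "'a::euclidean_space set \<Rightarrow> ('a \<Rightarrow> real) set \<Rightarrow> (nat \<Rightarrow> 'a \<Rightarrow> real) \<Rightarrow> bool" where
  "pnp_uniquely_solvable \<Omega> V F \<longleftrightarrow>
     (\<exists>p \<phi>. pnp_solution \<Omega> V F p \<phi>) \<and>
     (\<forall>p \<phi> p' \<phi>'. pnp_solution \<Omega> V F p \<phi> \<and> pnp_solution \<Omega> V F p' \<phi>' \<longrightarrow>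
        (AE x in lebesgue_on \<Omega>. p 1 x = p' 1 x \<and> p 2 x = p' 2 x \<and> \<phi> x = \<phi>' x))"

text \<open>
  The arguments \<open>pH\<close>, \<open>\<phi>H\<close> are the coarse solution, \<open>ps\<close>, \<open>\<phi>s\<close> the two-grid
  solution in the fine space \<open>V\<close>.
\<close>

definition decoupled_two_grid_solution ::
  "'a::euclidean_space set \<Rightarrow> ('a \<Rightarrow> real) set \<Rightarrow> (nat \<Rightarrow> 'a \<Rightarrow> real) \<Rightarrow>
   (nat \<Rightarrow> 'a \<Rightarrow> real) \<Rightarrow> ('a \<Rightarrow> real) \<Rightarrow> (nat \<Rightarrow> 'a \<Rightarrow> real) \<Rightarrow> ('a \<Rightarrow> real) \<Rightarrow> bool" where
  "decoupled_two_grid_solution \<Omega> V F pH \<phi>H ps \<phi>s \<longleftrightarrow>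
     (\<forall>i\<in>{1,2}. ps i \<in> V) \<and> \<phi>s \<in> V \<and>
     (\<forall>i\<in>{1,2}. \<forall>v\<in>V.
        L2_inner \<Omega> (wgrad \<Omega> (ps i)) (wgrad \<Omega> v)
        = L2_inner \<Omega> (F i) v
          - L2_inner \<Omega> (\<lambda>x. (q i * pH i x) *\<^sub>R wgrad \<Omega> \<phi>H x) (wgrad \<Omega> v)) \<and>
     (\<forall>w\<in>V. L2_inner \<Omega> (wgrad \<Omega> \<phi>s) (wgrad \<Omega> w)
        = (\<Sum>i\<in>{1,2}. q i * L2_inner \<Omega> (pH i) w) + L2_inner \<Omega> (F 3) w)"

end

theory Submission
  imports Defs
begin

text \<open>
  Subtract the two discrete equations for species \<open>i\<close> and test with the error
  \<open>e = ph i - ps i\<close> itself. Since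
  \<open>ph i \<nabla>\<phi>h - pH i \<nabla>\<phi>H = (ph i - pH i) \<nabla>\<phi>h + pH i \<nabla>(\<phi>h - \<phi>H)\<close>,
  the bounds on \<open>\<nabla>\<phi>h\<close> and \<open>pH i\<close> and the Cauchy--Schwarz inequality bound
  \<open>\<parallel>\<nabla>e\<parallel>\<^sup>2\<close> by a multiple of \<open>\<parallel>\<nabla>e\<parallel>\<close> times the right-hand side.

  The chosen representatives \<open>wgrad\<close> are additive almost everywhere only because weak gradients are
  unique. This is the fundamental lemma of the calculus of variations: indicators of boxes are bounded
  limits of test functions, and an integrable function whose integrals over all boxes vanish is zero
  almost everywhere.
\<close>

subsection \<open>Smooth functions\<close>

text \<open>\<open>C_k\<close> refers to \<open>frechet_derivative\<close>, which is obtained by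
  choice. Uniqueness of the derivative allows any explicit formula \<open>f'\<close> to take its
  place.\<close>

lemma C_kI:
  assumes "\<And>x. (f has_derivative f' x) (at x)" and "\<And>b. b \<in> Basis \<Longrightarrow> C_k k (\<lambda>x. f' x b)"
  shows "C_k (Suc k) f"
proof -
  have "frechet_derivative f (at x) = f' x" for x
    using frechet_derivative_at[OF assms(1)] by simp
  then show ?thesis
    using assms by (auto simp: differentiable_def)
qed

text \<open>Differentiability gives continuity in the base case, and the step passes to the partial
  derivatives. The product and chain rules need this because they retain undifferentiated
  factors.\<close>

lemma C_k_SucD: "C_k (Suc k) f \<Longrightarrow> C_k k f"
proof (induction k arbitrary: f)
  case 0
  then show ?case
    by (auto intro!: continuous_at_imp_continuous_on differentiable_imp_continuous_within)
next
  case (Suc k)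
  then have "\<And>b. b \<in> Basis \<Longrightarrow> C_k (Suc k) (\<lambda>x. frechet_derivative f (at x) b)" and "\<forall>x. f differentiable at x"
    unfolding C_k.simps(2)[of "Suc k"] by blast+
  with Suc.IH show ?case
    by simp
qed

lemma C_k_has_derivative:
  "C_k (Suc k) f \<Longrightarrow> (f has_derivative frechet_derivative f (at x)) (at x)"
  by (simp add: frechet_derivative_works)

lemma C_k_const: "C_k k (\<lambda>_. c)"
  by (induction k arbitrary: c) (auto intro!: C_kI derivative_eq_intros)

lemma C_k_inner: "C_k k (\<lambda>x. x \<bullet> v)"
proof (cases k)
  case (Suc n)
  show ?thesis
    unfolding Suc by (rule C_kI[OF bounded_linear.has_derivative[OF bounded_linear_inner_left
        has_derivative_ident]]) (rule C_k_const)
qed (simp add: continuous_on_inner)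

lemma C_k_add: "C_k k f \<Longrightarrow> C_k k g \<Longrightarrow> C_k k (\<lambda>x. f x + g x)"
proof (induction k arbitrary: f g)
  case 0
  then show ?case by (auto intro: continuous_on_add continuous_on_mult)
next
  case (Suc k)
  show ?case
    by (rule C_kI[OF has_derivative_add[OF C_k_has_derivative C_k_has_derivative]])
      (use Suc in \<open>auto\<close>)
qed

lemma C_k_mult: "C_k k f \<Longrightarrow> C_k k g \<Longrightarrow> C_k k (\<lambda>x. f x * g x)"
proof (induction k arbitrary: f g)
  case 0
  then show ?case by (auto intro: continuous_on_add continuous_on_mult)
next
  case (Suc k)
  show ?case
    by (rule C_kI[OF has_derivative_mult[OF C_k_has_derivative C_k_has_derivative]])
      (use Suc C_k_SucD[OF Suc.prems(1)] C_k_SucD[OF Suc.prems(2)] in \<open>auto intro!: C_k_add\<close>)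
qed

lemma C_k_prod: "(\<And>i. i \<in> I \<Longrightarrow> C_k k (f i)) \<Longrightarrow> C_k k (\<lambda>x. \<Prod>i\<in>I. f i x)"
  by (induction I rule: infinite_finite_induct) (auto intro: C_k_const C_k_mult)

text \<open>The whole sequence of successive derivatives of the outer function is carried along: the
  chain rule turns \<open>G n\<close> into \<open>G (Suc n)\<close> times a partial derivative of
  \<open>f\<close>, so the induction must leave \<open>n\<close> arbitrary.\<close>

lemma C_k_compose:
  fixes G :: "nat \<Rightarrow> real \<Rightarrow> real"
  assumes G: "\<And>n t. (G n has_real_derivative G (Suc n) t) (at t)" and "C_k k f"
  shows "C_k k (\<lambda>x. G n (f x))"
  using assms(2)
proof (induction k arbitrary: n)
  case 0
  have "continuous_on UNIV (G n)"
    using G DERIV_isCont by (blast intro: continuous_at_imp_continuous_on)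
  with 0 show ?case
    by (auto intro: continuous_on_compose2)
next
  case (Suc k)
  have "((\<lambda>x. G n (f x)) has_derivative (\<lambda>y. frechet_derivative f (at x) y * G (Suc n) (f x))) (at x)" for x
    by (rule DERIV_compose_FDERIV[OF G C_k_has_derivative[OF Suc.prems]])
  then show ?case
    by (rule C_kI) (use Suc C_k_SucD[OF Suc.prems] in \<open>auto intro!: C_k_mult\<close>)
qed

text \<open>The polynomial factor closes the family under differentiation.\<close>

definition flat :: "real poly \<Rightarrow> real \<Rightarrow> real" where
  "flat p t = (if t \<le> 0 then 0 else poly p (inverse t) * exp (- inverse t))"

lemma poly_times_exp_minus_tendsto_0: "((\<lambda>y::real. poly p y * exp (- y)) \<longlongrightarrow> 0) at_top"
proof -
  have "((\<lambda>y. \<Sum>i\<le>degree p. coeff p i * (y ^ i / exp y)) \<longlongrightarrow> (\<Sum>i\<le>degree p. coeff p i * 0)) at_top"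
    by (intro tendsto_sum tendsto_mult tendsto_const tendsto_power_div_exp_0)
  then show ?thesis
    by (simp add: poly_altdef exp_minus divide_inverse sum_distrib_right mult.assoc)
qed

text \<open>For t > 0 the product rule gives (p - p')(1/t) exp(-1/t) / t^2, and the factor 1/t^2 is
  the polynomial X^2 evaluated at 1/t. At t = 0 the one-sided difference quotients are treated
  separately.\<close>

lemma DERIV_flat:
  "(flat p has_real_derivative flat ([:0, 0, 1:] * (p - pderiv p)) t) (at t)"
proof (cases t "0::real" rule: linorder_cases)
  case less
  have "(flat p has_real_derivative 0) (at t) \<longleftrightarrow> ((\<lambda>_. 0) has_real_derivative 0) (at t)"
    using less by (intro DERIV_cong_ev refl eventually_mono[OF eventually_nhds_in_open[of "{..<0}"]])
      (auto simp: flat_def)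
  then show ?thesis
    using less by (simp add: flat_def)
next
  case greater
  have "((\<lambda>s. poly p (inverse s) * exp (- inverse s)) has_real_derivative
      flat ([:0, 0, 1:] * (p - pderiv p)) t) (at t)"
    using greater
    by (intro DERIV_cong[OF DERIV_mult[OF DERIV_chain2[OF poly_DERIV DERIV_inverse]
          DERIV_chain2[OF DERIV_exp DERIV_minus[OF DERIV_inverse]]]])
      (simp_all add: flat_def algebra_simps)
  moreover have "eventually (\<lambda>s. flat p s = poly p (inverse s) * exp (- inverse s)) (nhds t)"
    using greater by (intro eventually_mono[OF eventually_nhds_in_open[of "{0<..}"]]) (auto simp: flat_def)
  ultimately show ?thesis
    by (subst DERIV_cong_ev[OF refl _ refl]) auto
next
  case equal
  have "((\<lambda>h. flat p h / h) \<longlongrightarrow> 0) (at_left 0)"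
    by (rule tendsto_eventually) (auto simp: flat_def eventually_at_filter)
  \<comment> \<open>The quotient by \<open>h\<close> multiplies the polynomial by X. With y = 1/h
    tending to infinity, exponential decay beats X p(X) at y.\<close>
  moreover have "((\<lambda>h. flat p h / h) \<longlongrightarrow> 0) (at_right 0)"
  proof (rule Lim_transform_eventually)
    show "((\<lambda>h. poly ([:0, 1:] * p) (inverse h) * exp (- inverse h)) \<longlongrightarrow> 0) (at_right (0::real))"
      by (rule filterlim_compose[OF poly_times_exp_minus_tendsto_0 filterlim_inverse_at_top_right])
    show "\<forall>\<^sub>F h in at_right 0. poly ([:0, 1:] * p) (inverse h) * exp (- inverse h) = flat p h / h"
      by (auto simp: eventually_at_filter flat_def field_simps)
  qed
  ultimately have "((\<lambda>h. flat p h / h) \<longlongrightarrow> 0) (at 0)"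
    by (simp add: filterlim_at_split)
  then show ?thesis
    using equal by (simp add: flat_def DERIV_def)
qed

text \<open>Iterating the map from p to X^2 (p - p') lists all derivatives of \<open>flat p\<close>,
  which is the sequence that \<open>C_k_compose\<close> asks for.\<close>

lemma C_k_flat: "C_k k f \<Longrightarrow> C_k k (\<lambda>x. flat p (f x))"
  using C_k_compose[where G = "\<lambda>n. flat (((\<lambda>p. [:0, 0, 1:] * (p - pderiv p)) ^^ n) p)" and n = 0]
    DERIV_flat by (simp del: mult_pCons_left)

lemma C_k_exp: "C_k k f \<Longrightarrow> C_k k (\<lambda>x. exp (f x))"
  by (rule C_k_compose[where G = "\<lambda>_. exp"]) (rule DERIV_exp)

lemma ex_smooth_positive_on_box:
  obtains \<psi> :: "'a::euclidean_space \<Rightarrow> real" where "\<And>k. C_k k \<psi>" "\<And>x. x \<in> box c d \<Longrightarrow> 0 < \<psi> x"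
    "\<And>x. x \<notin> box c d \<Longrightarrow> \<psi> x = 0"
proof
  \<comment> \<open>\<open>flat 1 t\<close> is exp(-1/t) for t > 0 and 0 otherwise. Each coordinate
    contributes its signed distances to the two faces, so one factor vanishes as soon as the point
    leaves the open box.\<close>
  let ?\<psi> = "\<lambda>x. \<Prod>b\<in>Basis. flat 1 (x \<bullet> b + - c \<bullet> b) * flat 1 (x \<bullet> - b + d \<bullet> b)"
  show "C_k k ?\<psi>" for k
    by (intro C_k_prod C_k_mult C_k_flat C_k_add C_k_inner C_k_const)
  show "0 < ?\<psi> x" if "x \<in> box c d" for x
    using that by (auto simp: mem_box flat_def intro!: prod_pos)
  show "?\<psi> x = 0" if "x \<notin> box c d" for x
    using that by (auto simp: mem_box flat_def not_less)
qed

subsection \<open>The fundamental lemma of the calculus of variations\<close>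

text \<open>Open boxes form an intersection-stable generator of the Borel sets, and the sets over
  which \<open>f\<close> integrates to 0 are closed under complements and countable disjoint unions.
  Completion extends this to Lebesgue sets, and a density is determined by its integrals.\<close>

lemma AE_zero_if_box_integrals_zero:
  fixes f :: "'a::euclidean_space \<Rightarrow> real"
  assumes f: "integrable lebesgue f"
    and box: "\<And>a b. set_lebesgue_integral lebesgue (box a b) f = 0"
  shows "AE x in lebesgue. f x = 0"
proof -
  have int: "set_integrable lebesgue A f" if "A \<in> sets lebesgue" for A
    using f that unfolding set_integrable_def by (rule integrable_mult_indicator[rotated])
  \<comment> \<open>Boxes growing to the whole space give the total integral, which the complement
    case below requires.\<close>
  have univ: "integral\<^sup>L lebesgue f = 0"
  proof -
    let ?A = "\<lambda>n. box (- (real n *\<^sub>R One)) (real n *\<^sub>R One) :: 'a set"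
    have "incseq ?A"
      by (auto simp: incseq_def subset_box)
    then have "(\<lambda>n. set_lebesgue_integral lebesgue (?A n) f) \<longlonglongrightarrow> set_lebesgue_integral lebesgue (\<Union>n. ?A n) f"
      by (intro set_integral_cont_up int) auto
    then show ?thesis
      unfolding box UN_box_eq_UNIV by (simp add: LIMSEQ_const_iff set_lebesgue_integral_def)
  qed
  have borel: "set_lebesgue_integral lebesgue A f = 0" if "A \<in> sets borel" for A
  proof -
    have sets: "sigma_sets UNIV (range (\<lambda>(a, b). box a b :: 'a set)) = sets borel"
      by (simp add: borel_eq_box)
    have "Int_stable (range (\<lambda>(a, b). box a b :: 'a set))"
      by (auto simp: Int_stable_def box_Int_box)
    moreover have "range (\<lambda>(a, b). box a b :: 'a set) \<subseteq> Pow UNIV"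
      by simp
    moreover have "A \<in> sigma_sets UNIV (range (\<lambda>(a, b). box a b))"
      using that by (simp add: borel_eq_box)
    ultimately show ?thesis
    proof (induction A rule: sigma_sets_induct_disjoint)
      case (basic A)
      then show ?case using box by auto
    next
      case empty
      show ?case by (simp add: set_lebesgue_integral_def)
    next
      case (compl A)
      then have A: "A \<in> sets lebesgue" and cA: "UNIV - A \<in> sets lebesgue"
        unfolding sets by auto
      have "set_lebesgue_integral lebesgue (A \<union> (UNIV - A)) f = 0"
        using univ by (simp add: set_lebesgue_integral_def)
      then show ?case
        using set_integral_Un[OF _ int[OF A] int[OF cA]] compl.IH by auto
    next
      case (union A)
      then have A: "A i \<in> sets lebesgue" for i
        unfolding sets by auto
      show ?case
        by (subst lebesgue_integral_countable_add)
          (use union A in \<open>auto simp: disjoint_family_on_def intro!: int\<close>)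
    qed
  qed
  \<comment> \<open>A Lebesgue set is a Borel set together with a subset of a null set, which the
    integral does not see.\<close>
  have "set_lebesgue_integral lebesgue A f = 0" if A: "A \<in> sets lebesgue" for A
  proof -
    obtain S N N' where S: "A = S \<union> N" "N \<subseteq> N'" "N' \<in> null_sets lborel" "S \<in> sets lborel"
      using sets_completionE[OF A] by metis
    have "AE x in lebesgue. x \<notin> N'"
      using S(3) by (intro AE_completion AE_not_in)
    then have "set_lebesgue_integral lebesgue A f = set_lebesgue_integral lebesgue S f"
      using int[OF A] int[of S] S
      by (intro set_integral_cong_set) (auto simp: set_borel_measurable_def set_integrable_def)
    then show ?thesis
      using borel S by auto
  qed
  then show ?thesis
    using density_unique_real[OF f, of "\<lambda>_. 0"] by simp
qed

lemma indicator_subset_mult: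
  "A \<subseteq> B \<Longrightarrow> indicator B x * (indicator A x * y) = indicator A x * (y :: real)"
  by (auto simp: indicator_def)

text \<open>An open set is a countable union of closed boxes inside it, so only countably many
  exceptional null sets are combined.\<close>

lemma AE_on_open_if_AE_on_cboxes:
  fixes \<Omega> :: "'a::euclidean_space set"
  assumes "open \<Omega>" and "\<And>c d. cbox c d \<subseteq> \<Omega> \<Longrightarrow> AE x in lebesgue. x \<in> cbox c d \<longrightarrow> P x"
  shows "AE x in lebesgue_on \<Omega>. P x"
proof -
  obtain \<D> where D: "countable \<D>" "\<D> \<subseteq> Pow \<Omega>" "\<And>X. X \<in> \<D> \<Longrightarrow> \<exists>a b. X = cbox a b" "\<Union>\<D> = \<Omega>"
    using open_countable_Union_open_cbox[OF \<open>open \<Omega>\<close>] by metis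
  have "AE x in lebesgue. \<forall>X\<in>\<D>. x \<in> X \<longrightarrow> P x"
    using D assms(2) by (intro AE_ball_countable') (auto, blast)
  then have "AE x in lebesgue. x \<in> \<Omega> \<longrightarrow> P x"
    by (rule AE_mp) (use D(4) in auto)
  then show ?thesis
    using \<open>open \<Omega>\<close> by (subst AE_restrict_space_iff) auto
qed

lemma test_functions_continuous: "\<psi> \<in> test_functions \<Omega> \<Longrightarrow> continuous_on UNIV \<psi>"
  using C_k.simps(1) unfolding test_functions_def by blast

text \<open>On the compact set \<open>K\<close> the factor \<psi> is bounded and \<open>f\<close> is
  integrable; off \<open>K\<close> the product is zero.\<close>

lemma L1_loc_mult_integrable:
  fixes f \<psi> :: "'a::euclidean_space \<Rightarrow> real"
  assumes "open \<Omega>" "f \<in> L1_loc \<Omega>" "continuous_on UNIV \<psi>" "compact K" "K \<subseteq> \<Omega>" "\<And>x. x \<notin> K \<Longrightarrow> \<psi> x = 0"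
  shows "integrable (lebesgue_on \<Omega>) (\<lambda>x. f x * \<psi> x)"
proof -
  have K: "K \<in> sets lebesgue" and \<Omega>: "\<Omega> \<in> sets lebesgue"
    using assms lmeasurable_compact by auto
  obtain C where C: "\<And>x. x \<in> K \<Longrightarrow> \<bar>\<psi> x\<bar> \<le> C"
    using compact_imp_bounded[OF compact_continuous_image[OF continuous_on_subset[OF assms(3)] \<open>compact K\<close>]]
    by (auto simp: bounded_iff)
  have fK: "integrable (lebesgue_on K) f"
    using assms by (simp add: L1_loc_def)
  then have [measurable]: "f \<in> borel_measurable (lebesgue_on K)"
    by simp
  have [measurable]: "\<psi> \<in> borel_measurable (lebesgue_on K)"
    using continuous_on_subset[OF assms(3)] K by (auto intro: continuous_imp_measurable_on_sets_lebesgue)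
  have "integrable (lebesgue_on K) (\<lambda>x. f x * \<psi> x)"
  proof (rule Bochner_Integration.integrable_bound[OF integrable_mult_left[OF fK]])
    show "AE x in lebesgue_on K. norm (f x * \<psi> x) \<le> norm (f x * C)"
    proof (rule AE_I2)
      fix x assume "x \<in> space (lebesgue_on K)"
      then have "\<bar>\<psi> x\<bar> \<le> \<bar>C\<bar>"
        using C[of x] by auto
      then show "norm (f x * \<psi> x) \<le> norm (f x * C)"
        by (simp add: abs_mult mult_left_mono)
    qed
  qed measurable
  moreover have "(\<lambda>x. indicator \<Omega> x * (f x * \<psi> x)) = (\<lambda>x. indicator K x * (f x * \<psi> x))"
    using assms(5,6) by (auto simp: indicator_def fun_eq_iff)
  ultimately show ?thesis
    using K \<Omega> by (simp add: integrable_restrict_space)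
qed

text \<open>This replaces mollification. The closed box is a common compact support inside \<Omega>,
  and the uniform bound makes dominated convergence applicable.\<close>

lemma indicator_box_limit_test_functions:
  fixes c d :: "'a::euclidean_space"
  assumes "cbox c d \<subseteq> \<Omega>"
  obtains \<psi> :: "nat \<Rightarrow> 'a \<Rightarrow> real" where "\<And>n. \<psi> n \<in> test_functions \<Omega>"
    "\<And>n x. \<bar>\<psi> n x\<bar> \<le> indicator (cbox c d) x" "\<And>x. (\<lambda>n. \<psi> n x) \<longlonglongrightarrow> indicator (box c d) x"
proof -
  obtain \<phi> :: "'a \<Rightarrow> real" where \<phi>: "\<And>k. C_k k \<phi>" "\<And>x. x \<in> box c d \<Longrightarrow> 0 < \<phi> x"
    "\<And>x. x \<notin> box c d \<Longrightarrow> \<phi> x = 0"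
    using ex_smooth_positive_on_box by metis
  \<comment> \<open>\<open>1 - exp (- n t)\<close>, a sum of products to suit \<open>C_k_add\<close> and \<open>C_k_mult\<close>, tends to 1 for \<open>t > 0\<close> and vanishes at \<open>t = 0\<close>.\<close>
  let ?\<psi> = "\<lambda>n x. 1 + - 1 * exp (- real n * \<phi> x)"
  have "C_k k (?\<psi> n)" for n k
    by (intro C_k_add C_k_mult C_k_exp C_k_const \<phi>)
  moreover have "x \<notin> cbox c d \<longrightarrow> ?\<psi> n x = 0" for n x
    using \<phi>(3)[of x] box_subset_cbox[of c d] by auto
  ultimately have "?\<psi> n \<in> test_functions \<Omega>" for n
    using assms compact_cbox unfolding test_functions_def
    by (intro CollectI conjI allI exI[of _ "cbox c d"]) blast+
  moreover have "\<bar>?\<psi> n x\<bar> \<le> indicator (cbox c d) x" for n x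
    using \<phi>(2,3)[of x] box_subset_cbox[of c d] by (cases "x \<in> box c d") (auto simp: indicator_def abs_if mult_less_0_iff)
  moreover have "(\<lambda>n. ?\<psi> n x) \<longlonglongrightarrow> indicator (box c d) x" for x
  proof (cases "x \<in> box c d")
    case True
    then have "(\<lambda>n. exp (- \<phi> x) ^ n) \<longlonglongrightarrow> 0"
      using \<phi>(2) by (intro LIMSEQ_realpow_zero) auto
    then have "(\<lambda>n. 1 + - 1 * exp (- \<phi> x) ^ n) \<longlonglongrightarrow> 1 + - 1 * 0"
      by (intro tendsto_add tendsto_mult tendsto_const)
    then show ?thesis
      using True by (simp add: exp_of_nat_mult[symmetric])
  qed (simp add: \<phi>)
  ultimately show thesis
    using that[of ?\<psi>] by blast
qed

text \<open>Approximating indicators by test functions shows that \<open>f\<close> integrates to 0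
  over every open box whose closed box lies in \<Omega>. For a fixed closed box in \<Omega>, the
  function \<open>f\<close> cut off to it is integrable on the whole space, so the criterion on box
  integrals applies there.\<close>

lemma fundamental_lemma_of_calculus_of_variations:
  fixes f :: "'a::euclidean_space \<Rightarrow> real"
  assumes "open \<Omega>" and f: "f \<in> L1_loc \<Omega>"
    and zero: "\<And>\<psi>. \<psi> \<in> test_functions \<Omega> \<Longrightarrow> (\<integral>x. f x * \<psi> x \<partial>lebesgue_on \<Omega>) = 0"
  shows "AE x in lebesgue_on \<Omega>. f x = 0"
proof (rule AE_on_open_if_AE_on_cboxes[OF \<open>open \<Omega>\<close>])
  have \<Omega>: "\<Omega> \<in> sets lebesgue"
    using \<open>open \<Omega>\<close> by auto
  have int: "integrable lebesgue (\<lambda>x. indicator (cbox c d) x * f x)" if "cbox c d \<subseteq> \<Omega>" for c d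
    using f that compact_cbox[of c d] integrable_restrict_space[of "cbox c d" lebesgue f]
    by (auto simp: L1_loc_def)
  have box: "integral\<^sup>L lebesgue (\<lambda>x. indicator (box c d) x * f x) = 0" if cd: "cbox c d \<subseteq> \<Omega>" for c d
  proof -
    obtain \<psi> :: "nat \<Rightarrow> 'a \<Rightarrow> real" where \<psi>: "\<And>n. \<psi> n \<in> test_functions \<Omega>"
      "\<And>n x. \<bar>\<psi> n x\<bar> \<le> indicator (cbox c d) x" "\<And>x. (\<lambda>n. \<psi> n x) \<longlonglongrightarrow> indicator (box c d) x"
      using indicator_box_limit_test_functions[OF cd] by metis
    have \<psi>m[measurable]: "\<psi> n \<in> borel_measurable (lebesgue_on \<Omega>)" for n
      using test_functions_continuous[OF \<psi>(1)] continuous_on_subset \<Omega>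
      by (blast intro: continuous_imp_measurable_on_sets_lebesgue)
    have [measurable]: "f \<in> borel_measurable (lebesgue_on \<Omega>)"
      using f by (simp add: L1_loc_def)
    have [measurable]: "(indicator (box c d) :: 'a \<Rightarrow> real) \<in> borel_measurable (lebesgue_on \<Omega>)"
      by (intro measurable_restrict_space1 borel_measurable_indicator) auto
    have "(\<lambda>n. \<integral>x. f x * \<psi> n x \<partial>lebesgue_on \<Omega>) \<longlonglongrightarrow> (\<integral>x. f x * indicator (box c d) x \<partial>lebesgue_on \<Omega>)"
    proof (rule integral_dominated_convergence[where w = "\<lambda>x. indicator (cbox c d) x * \<bar>f x\<bar>"])
      show "integrable (lebesgue_on \<Omega>) (\<lambda>x. indicator (cbox c d) x * \<bar>f x\<bar>)"
        using integrable_abs[OF int[OF cd]] cd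
        by (simp add: integrable_restrict_space \<Omega> abs_mult indicator_subset_mult)
      show "AE x in lebesgue_on \<Omega>. norm (f x * \<psi> n x) \<le> indicator (cbox c d) x * \<bar>f x\<bar>" for n
        using \<psi>(2) by (auto simp: abs_mult mult.commute intro!: mult_left_mono)
    qed (auto intro!: tendsto_intros \<psi>)
    then have "(\<integral>x. f x * indicator (box c d) x \<partial>lebesgue_on \<Omega>) = 0"
      by (simp add: zero[OF \<psi>(1)] LIMSEQ_const_iff)
    then show ?thesis
      using cd box_subset_cbox[of c d]
      by (simp add: integral_restrict_space \<Omega> indicator_subset_mult mult.commute[of "f _"])
  qed
  fix c d assume cd: "cbox c d \<subseteq> \<Omega>"
  have "AE x in lebesgue. indicator (cbox c d) x * f x = 0"
  proof (rule AE_zero_if_box_integrals_zero[OF int[OF cd]])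
    fix a b :: 'a
    \<comment> \<open>The same corners describe both intersections: the closed one supplies
      integrability of \<open>f\<close>, the open one the vanishing integral. They can be exchanged
      because the boundary of a box is a null set.\<close>
    obtain u v where uv: "cbox a b \<inter> cbox c d = cbox u v" "box a b \<inter> box c d = box u v"
      by (rule that[OF Int_interval box_Int_box])
    have "cbox c d - box c d \<in> null_sets lebesgue"
      using negligible_frontier_interval negligible_iff_null_sets by blast
    then have AE: "AE x in lebesgue. x \<notin> cbox c d - box c d"
      by (rule AE_not_in)
    have "set_lebesgue_integral lebesgue (box a b) (\<lambda>x. indicator (cbox c d) x * f x)
        = integral\<^sup>L lebesgue (\<lambda>x. indicator (box u v) x * f x)"
      unfolding set_lebesgue_integral_def
    proof (rule integral_cong_AE)
      show "(\<lambda>x. indicator (box a b) x *\<^sub>R (indicator (cbox c d) x * f x)) \<in> borel_measurable lebesgue"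
        by (intro borel_measurable_integrable integrable_mult_indicator int[OF cd]) auto
      have "integrable lebesgue (\<lambda>x. indicator (cbox u v) x * f x)"
        using int[of u v] uv(1) cd by auto
      then have "integrable lebesgue (\<lambda>x. indicator (box u v) x *\<^sub>R (indicator (cbox u v) x * f x))"
        by (intro integrable_mult_indicator) auto
      also have "(\<lambda>x. indicator (box u v) x *\<^sub>R (indicator (cbox u v) x * f x)) = (\<lambda>x. indicator (box u v) x * f x)"
        using box_subset_cbox[of u v] by (auto simp: indicator_def fun_eq_iff)
      finally show "(\<lambda>x. indicator (box u v) x * f x) \<in> borel_measurable lebesgue"
        by simp
      show "AE x in lebesgue. indicator (box a b) x *\<^sub>R (indicator (cbox c d) x * f x) = indicator (box u v) x * f x"
        using AE by (rule AE_mp) (use uv(2) box_subset_cbox[of c d] in \<open>auto simp: indicator_def\<close>)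
    qed
    then show "set_lebesgue_integral lebesgue (box a b) (\<lambda>x. indicator (cbox c d) x * f x) = 0"
      using box[of u v] uv(1) cd by auto
  qed
  then show "AE x in lebesgue. x \<in> cbox c d \<longrightarrow> f x = 0"
    by (rule AE_mp) (auto simp: indicator_def)
qed

section \<open>Locally integrable functions paired with test functions\<close>

lemma L1_loc_inner: "g \<in> L1_loc \<Omega> \<Longrightarrow> (\<lambda>x. g x \<bullet> b) \<in> L1_loc \<Omega>"
  by (auto simp: L1_loc_def)

lemma L1_loc_diff: "f \<in> L1_loc \<Omega> \<Longrightarrow> g \<in> L1_loc \<Omega> \<Longrightarrow> (\<lambda>x. f x - g x) \<in> L1_loc \<Omega>"
  by (auto simp: L1_loc_def)

lemma L1_loc_mult_test_function_integrable:
  assumes "open \<Omega>" "f \<in> L1_loc \<Omega>" "\<psi> \<in> test_functions \<Omega>"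
  shows "integrable (lebesgue_on \<Omega>) (\<lambda>x. f x * \<psi> x)"
proof -
  obtain K where "compact K" "K \<subseteq> \<Omega>" "\<And>x. x \<notin> K \<Longrightarrow> \<psi> x = 0"
    using assms(3) unfolding test_functions_def by blast
  then show ?thesis
    using assms by (intro L1_loc_mult_integrable test_functions_continuous)
qed

text \<open>The complement of the compact support \<open>K\<close> is open, so the derivative also
  vanishes there and \<open>K\<close> serves again.\<close>

lemma L1_loc_mult_test_function_derivative_integrable:
  assumes "open \<Omega>" "f \<in> L1_loc \<Omega>" "\<psi> \<in> test_functions \<Omega>" "b \<in> Basis"
  shows "integrable (lebesgue_on \<Omega>) (\<lambda>x. f x * frechet_derivative \<psi> (at x) b)"
proof -
  obtain K where K: "compact K" "K \<subseteq> \<Omega>" "\<And>x. x \<notin> K \<Longrightarrow> \<psi> x = 0"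
    using assms(3) unfolding test_functions_def by blast
  have "C_k (Suc 0) \<psi>"
    using assms(3) unfolding test_functions_def by blast
  then have "continuous_on UNIV (\<lambda>x. frechet_derivative \<psi> (at x) b)"
    using assms(4) by simp
  moreover have "frechet_derivative \<psi> (at x) b = 0" if "x \<notin> K" for x
  proof -
    have "(\<psi> has_derivative (\<lambda>_. 0)) (at x)"
      using K that by (intro has_derivative_transform_within_open[OF has_derivative_const, of "- K"])
        (auto intro: compact_imp_closed)
    then show ?thesis
      using frechet_derivative_at by metis
  qed
  ultimately show ?thesis
    using assms(1,2) K by (intro L1_loc_mult_integrable)
qed

subsection \<open>Weak gradients and \<open>L2\<close> estimates\<close>

lemma has_weak_gradient_diff:
  assumes "open \<Omega>" and u: "has_weak_gradient \<Omega> u g" and v: "has_weak_gradient \<Omega> v k"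
  shows "has_weak_gradient \<Omega> (\<lambda>x. u x - v x) (\<lambda>x. g x - k x)"
  unfolding has_weak_gradient_def
proof (intro conjI ballI)
  have L: "u \<in> L1_loc \<Omega>" "v \<in> L1_loc \<Omega>" "g \<in> L1_loc \<Omega>" "k \<in> L1_loc \<Omega>"
    using u v by (auto simp: has_weak_gradient_def)
  show "(\<lambda>x. u x - v x) \<in> L1_loc \<Omega>" "(\<lambda>x. g x - k x) \<in> L1_loc \<Omega>"
    using L by (auto intro: L1_loc_diff)
  fix \<psi> and b :: 'a assume \<psi>: "\<psi> \<in> test_functions \<Omega>" and b: "b \<in> Basis"
  note int = L1_loc_mult_test_function_integrable[OF \<open>open \<Omega>\<close> L1_loc_inner \<psi>]
    L1_loc_mult_test_function_derivative_integrable[OF \<open>open \<Omega>\<close> _ \<psi> b]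
  have "(\<integral>x. u x * frechet_derivative \<psi> (at x) b \<partial>lebesgue_on \<Omega>) = - (\<integral>x. (g x \<bullet> b) * \<psi> x \<partial>lebesgue_on \<Omega>)"
    "(\<integral>x. v x * frechet_derivative \<psi> (at x) b \<partial>lebesgue_on \<Omega>) = - (\<integral>x. (k x \<bullet> b) * \<psi> x \<partial>lebesgue_on \<Omega>)"
    using u v \<psi> b by (auto simp: has_weak_gradient_def)
  then show "(\<integral>x. (u x - v x) * frechet_derivative \<psi> (at x) b \<partial>lebesgue_on \<Omega>) =
      - (\<integral>x. ((g x - k x) \<bullet> b) * \<psi> x \<partial>lebesgue_on \<Omega>)"
    using L by (simp add: left_diff_distrib inner_diff_left int)
qed

text \<open>The difference of two weak gradients of \<open>u\<close> is a weak gradient of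
  \<open>u - u\<close>, that is, of zero. The fundamental lemma then applies to each of its finitely
  many components.\<close>

lemma has_weak_gradient_unique:
  assumes "open \<Omega>" and g: "has_weak_gradient \<Omega> u g" and k: "has_weak_gradient \<Omega> u k"
  shows "AE x in lebesgue_on \<Omega>. g x = k x"
proof -
  have gk: "has_weak_gradient \<Omega> (\<lambda>x. u x - u x) (\<lambda>x. g x - k x)"
    using assms by (rule has_weak_gradient_diff)
  have "AE x in lebesgue_on \<Omega>. (g x - k x) \<bullet> b = 0" if "b \<in> Basis" for b
    using gk that \<open>open \<Omega>\<close>
    by (intro fundamental_lemma_of_calculus_of_variations L1_loc_inner) (auto simp: has_weak_gradient_def)
  then have "AE x in lebesgue_on \<Omega>. \<forall>b\<in>Basis. (g x - k x) \<bullet> b = 0"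
    by (intro AE_finite_allI) auto
  then show ?thesis
    by eventually_elim (rule euclidean_eqI, simp add: inner_diff_left)
qed

lemma has_weak_gradient_wgrad: "has_weak_gradient \<Omega> u g \<Longrightarrow> has_weak_gradient \<Omega> u (wgrad \<Omega> u)"
  unfolding wgrad_def by (rule someI[of "has_weak_gradient \<Omega> u"])

lemma wgrad_measurable:
  "has_weak_gradient \<Omega> u g \<Longrightarrow> wgrad \<Omega> u \<in> borel_measurable (lebesgue_on \<Omega>)"
  by (drule has_weak_gradient_wgrad) (simp add: has_weak_gradient_def L1_loc_def)

section \<open>Square integrable functions and the Cauchy--Schwarz inequality\<close>

lemma L2_measurable: "f \<in> L2 \<Omega> \<Longrightarrow> f \<in> borel_measurable (lebesgue_on \<Omega>)"
  by (simp add: L2_def)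

lemma L2_norm_mult_integrable:
  assumes "f \<in> L2 \<Omega>" "g \<in> L2 \<Omega>"
  shows "integrable (lebesgue_on \<Omega>) (\<lambda>x. norm (f x) * norm (g x))"
proof (rule Bochner_Integration.integrable_bound)
  show "integrable (lebesgue_on \<Omega>) (\<lambda>x. (norm (f x))\<^sup>2 + (norm (g x))\<^sup>2)"
    using assms by (simp add: L2_def)
  show "(\<lambda>x. norm (f x) * norm (g x)) \<in> borel_measurable (lebesgue_on \<Omega>)"
    using assms[THEN L2_measurable] by measurable
  have "norm (norm a * norm b) \<le> norm ((norm a)\<^sup>2 + (norm b)\<^sup>2)" for a :: 'b and b :: 'c
  proof -
    have "0 \<le> norm a * norm b"
      by simp
    then show ?thesis
      using sum_squares_bound[of "norm a" "norm b"] by (simp add: abs_mult) (use \<open>0 \<le> norm a * norm b\<close> in argo)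
  qed
  then show "AE x in lebesgue_on \<Omega>. norm (norm (f x) * norm (g x)) \<le> norm ((norm (f x))\<^sup>2 + (norm (g x))\<^sup>2)"
    by (rule AE_I2)
qed

lemma L2_inner_integrable:
  assumes "f \<in> L2 \<Omega>" "g \<in> L2 \<Omega>"
  shows "integrable (lebesgue_on \<Omega>) (\<lambda>x. f x \<bullet> g x)"
  using assms[THEN L2_measurable]
  by (intro Bochner_Integration.integrable_bound[OF L2_norm_mult_integrable[OF assms]])
    (auto intro!: AE_I2 Cauchy_Schwarz_ineq2)

lemma L2_norm_nonneg: "0 \<le> L2_norm \<Omega> f"
  by (simp add: L2_norm_def L2_inner_def)

lemma L2_norm_power2: "(L2_norm \<Omega> f)\<^sup>2 = L2_inner \<Omega> f f"
  by (simp add: L2_norm_def L2_inner_def)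

text \<open>The integral of the square of s |f| - t |g| is nonnegative for all s and t. Using the
  product of norms instead of the inner product lets a scalar function be paired with a vector
  field, as the drift estimate requires.\<close>

lemma L2_Cauchy_Schwarz:
  assumes f: "f \<in> L2 \<Omega>" and g: "g \<in> L2 \<Omega>"
  shows "(\<integral>x. norm (f x) * norm (g x) \<partial>lebesgue_on \<Omega>) \<le> L2_norm \<Omega> f * L2_norm \<Omega> g"
proof -
  let ?c = "\<integral>x. norm (f x) * norm (g x) \<partial>lebesgue_on \<Omega>"
  let ?a = "L2_norm \<Omega> f" and ?b = "L2_norm \<Omega> g"
  have quad: "2 * s * t * ?c \<le> s\<^sup>2 * ?a\<^sup>2 + t\<^sup>2 * ?b\<^sup>2" for s t
  proof -
    have "0 \<le> (\<integral>x. (s * norm (f x) - t * norm (g x))\<^sup>2 \<partial>lebesgue_on \<Omega>)"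
      by simp
    also have "\<dots> = (\<integral>x. s\<^sup>2 * (norm (f x))\<^sup>2 + t\<^sup>2 * (norm (g x))\<^sup>2 - 2 * s * t * (norm (f x) * norm (g x)) \<partial>lebesgue_on \<Omega>)"
      by (intro Bochner_Integration.integral_cong) (auto simp: power2_diff power_mult_distrib)
    also have "\<dots> = s\<^sup>2 * ?a\<^sup>2 + t\<^sup>2 * ?b\<^sup>2 - 2 * s * t * ?c"
      using f g L2_norm_mult_integrable[OF f g]
      by (simp add: L2_def L2_norm_power2 L2_inner_def power2_norm_eq_inner)
    finally show ?thesis by simp
  qed
  show ?thesis
  proof (cases "?a * ?b = 0")
    case True
    have "?c \<le> 0"
    proof (rule ccontr)
      assume c: "\<not> ?c \<le> 0"
      from True show False
      proof (elim mult_eq_0_iff[THEN iffD1, THEN disjE])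
        assume "?a = 0"
        then show False
          \<comment> \<open>With \<open>?a = 0\<close> the inequality reads
            \<open>2 * s * ?c \<le> ?b\<^sup>2\<close> for \<open>t = 1\<close>; the chosen
            \<open>s\<close> makes the left side \<open>2 * (?b\<^sup>2 + 1)\<close>, which is too
            large.\<close>
          using quad[of "(?b\<^sup>2 + 1) / ?c" 1] c zero_le_power2[of ?b] by simp
      next
        assume "?b = 0"
        then show False
          using quad[of 1 "(?a\<^sup>2 + 1) / ?c"] c zero_le_power2[of ?a] by simp
      qed
    qed
    then show ?thesis
      using True by auto
  next
    case False
    then have "0 < ?a * ?b"
      using L2_norm_nonneg[of \<Omega> f] L2_norm_nonneg[of \<Omega> g] by (simp add: less_le)
    moreover have "?a * ?b * ?c \<le> ?a * ?b * (?a * ?b)"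
      \<comment> \<open>The choice s = \<open>?b\<close>, t = \<open>?a\<close> makes both squares
        on the right equal, and the positive factor \<open>?a * ?b\<close> cancels
        afterwards.\<close>
      using quad[of ?b ?a] by (simp add: power2_eq_square algebra_simps)
    ultimately show ?thesis
      by (rule mult_left_le_imp_le[rotated])
  qed
qed

lemma L2_diff:
  assumes "f \<in> L2 \<Omega>" "g \<in> L2 \<Omega>"
  shows "(\<lambda>x. f x - g x) \<in> L2 \<Omega>"
proof -
  have "integrable (lebesgue_on \<Omega>) (\<lambda>x. (norm (f x - g x))\<^sup>2)"
  proof (rule Bochner_Integration.integrable_cong[THEN iffD1])
    show "integrable (lebesgue_on \<Omega>) (\<lambda>x. (norm (f x))\<^sup>2 + (norm (g x))\<^sup>2 - 2 * (f x \<bullet> g x))"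
      using assms L2_inner_integrable[OF assms] by (simp add: L2_def)
  qed (auto simp: power2_norm_eq_inner inner_diff inner_commute)
  then show ?thesis
    using assms by (auto simp: L2_def intro: borel_measurable_diff)
qed

section \<open>Differences in H1 and in the finite element space\<close>

lemma H1_imp_L2: "u \<in> H1 \<Omega> \<Longrightarrow> u \<in> L2 \<Omega>"
  unfolding H1_def by (drule CollectD) (rule conjunct1)

text \<open>\<open>H1\<close> promises only some square integrable weak gradient, while
  \<open>wgrad\<close> may select another one. Uniqueness almost everywhere transfers square
  integrability to the selected one.\<close>

lemma H1_wgrad:
  assumes "open \<Omega>" "u \<in> H1 \<Omega>"
  shows "has_weak_gradient \<Omega> u (wgrad \<Omega> u)" "wgrad \<Omega> u \<in> L2 \<Omega>"
proof -
  obtain g where g: "g \<in> L2 \<Omega>" "has_weak_gradient \<Omega> u g"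
    using assms by (auto simp: H1_def)
  show *: "has_weak_gradient \<Omega> u (wgrad \<Omega> u)"
    by (rule has_weak_gradient_wgrad[OF g(2)])
  have [measurable]: "g \<in> borel_measurable (lebesgue_on \<Omega>)" "wgrad \<Omega> u \<in> borel_measurable (lebesgue_on \<Omega>)"
    using L2_measurable[OF g(1)] wgrad_measurable[OF *] by auto
  have "AE x in lebesgue_on \<Omega>. g x = wgrad \<Omega> u x"
    by (rule has_weak_gradient_unique[OF assms(1) g(2) *])
  then have "integrable (lebesgue_on \<Omega>) (\<lambda>x. (norm (g x))\<^sup>2) \<longleftrightarrow>
      integrable (lebesgue_on \<Omega>) (\<lambda>x. (norm (wgrad \<Omega> u x))\<^sup>2)"
    by (intro integrable_cong_AE) auto
  then show "wgrad \<Omega> u \<in> L2 \<Omega>"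
    using g(1) by (simp add: L2_def)
qed

lemma H1_diff:
  assumes "open \<Omega>" "u \<in> H1 \<Omega>" "v \<in> H1 \<Omega>"
  shows "(\<lambda>x. u x - v x) \<in> H1 \<Omega>"
proof -
  note u = H1_wgrad[OF assms(1,2)] and v = H1_wgrad[OF assms(1,3)]
  have "(\<lambda>x. u x - v x) \<in> L2 \<Omega>"
    by (rule L2_diff[OF H1_imp_L2[OF assms(2)] H1_imp_L2[OF assms(3)]])
  then show ?thesis
    using has_weak_gradient_diff[OF assms(1) u(1) v(1)] L2_diff[OF u(2) v(2)]
    unfolding H1_def by (intro CollectI conjI bexI)
qed

lemma wgrad_diff_AE:
  assumes "open \<Omega>" "u \<in> H1 \<Omega>" "v \<in> H1 \<Omega>"
  shows "AE x in lebesgue_on \<Omega>. wgrad \<Omega> (\<lambda>x. u x - v x) x = wgrad \<Omega> u x - wgrad \<Omega> v x"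
  by (rule has_weak_gradient_unique[OF assms(1) H1_wgrad(1)[OF assms(1) H1_diff[OF assms]]
        has_weak_gradient_diff[OF assms(1) H1_wgrad(1)[OF assms(1,2)] H1_wgrad(1)[OF assms(1,3)]]])

lemma fe_spaceD:
  assumes "v \<in> fe_space \<Omega> \<T>"
  shows "v \<in> H1 \<Omega>" "x \<in> frontier \<Omega> \<Longrightarrow> v x = 0" "e \<in> \<T> \<Longrightarrow> \<exists>a c. \<forall>x\<in>e. v x = a \<bullet> x + c"
proof -
  note v = assms[unfolded fe_space_def mem_Collect_eq]
  show "v \<in> H1 \<Omega>"
    by (rule v[THEN conjunct1])
  show "v x = 0" if "x \<in> frontier \<Omega>"
    by (rule v[THEN conjunct2, THEN conjunct1, THEN bspec, OF that])
  show "\<exists>a c. \<forall>x\<in>e. v x = a \<bullet> x + c" if "e \<in> \<T>"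
    by (rule v[THEN conjunct2, THEN conjunct2, THEN bspec, OF that])
qed

text \<open>This makes the error of two discrete solutions an admissible test function.\<close>

lemma fe_space_diff:
  assumes "open \<Omega>" and u: "u \<in> fe_space \<Omega> \<T>" and v: "v \<in> fe_space \<Omega> \<T>"
  shows "(\<lambda>x. u x - v x) \<in> fe_space \<Omega> \<T>"
  unfolding fe_space_def
proof (intro CollectI conjI ballI)
  show "(\<lambda>x. u x - v x) \<in> H1 \<Omega>"
    by (rule H1_diff[OF assms(1) fe_spaceD(1)[OF u] fe_spaceD(1)[OF v]])
  show "u x - v x = 0" if "x \<in> frontier \<Omega>" for x
    by (simp only: fe_spaceD(2)[OF u that] fe_spaceD(2)[OF v that] diff_self)
  fix e assume e: "e \<in> \<T>"
  obtain a c where a: "\<forall>x\<in>e. u x = a \<bullet> x + c"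
    using fe_spaceD(3)[OF u e] by (elim exE)
  obtain a' c' where a': "\<forall>x\<in>e. v x = a' \<bullet> x + c'"
    using fe_spaceD(3)[OF v e] by (elim exE)
  have "\<forall>x\<in>e. u x - v x = (a - a') \<bullet> x + (c - c')"
    using a a' by (simp add: inner_diff_left)
  then show "\<exists>a c. \<forall>x\<in>e. u x - v x = a \<bullet> x + c"
    by (intro exI)
qed

lemma Linf_norm_AE_bound:
  assumes "Linf_norm \<Omega> f \<le> ereal M"
  shows "AE x in lebesgue_on \<Omega>. norm (f x) \<le> M"
proof -
  have "AE x in lebesgue_on \<Omega>. ereal (norm (f x)) \<le> Linf_norm \<Omega> f"
    unfolding Linf_norm_def by (rule esssup_AE)
  then show ?thesis
  proof eventually_elim
    case (elim x)
    then show ?case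
      using order_trans[OF elim assms] by simp
  qed
qed

subsection \<open>The two-grid error\<close>

text \<open>The discrete space is kept abstract: closure under differences admits the error as a
  test function, and containment in \<open>H1\<close> supplies its weak gradient. The constant is
  the bound \<open>M\<close> itself, whatever the space \<open>V\<close>.\<close>

lemma decoupled_two_grid_error:
  assumes "open \<Omega>" and V: "V \<subseteq> H1 \<Omega>" "\<And>u v. u \<in> V \<Longrightarrow> v \<in> V \<Longrightarrow> (\<lambda>x. u x - v x) \<in> V"
    and fine: "pnp_solution \<Omega> V F ph \<phi>h"
    and two_grid: "decoupled_two_grid_solution \<Omega> V F pH \<phi>H ps \<phi>s"
    and i: "i \<in> {1, 2}" and pH: "pH i \<in> L2 \<Omega>" and \<phi>H: "\<phi>H \<in> H1 \<Omega>"
    and M\<phi>: "AE x in lebesgue_on \<Omega>. norm (wgrad \<Omega> \<phi>h x) \<le> M"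
    and Mp: "AE x in lebesgue_on \<Omega>. \<bar>pH i x\<bar> \<le> M" and "0 \<le> M"
  shows "L2_norm \<Omega> (wgrad \<Omega> (\<lambda>x. ph i x - ps i x))
    \<le> M * (L2_norm \<Omega> (\<lambda>x. ph i x - pH i x) + L2_norm \<Omega> (wgrad \<Omega> (\<lambda>x. \<phi>h x - \<phi>H x)))"
proof -
  let ?e = "\<lambda>x. ph i x - ps i x" and ?\<mu> = "lebesgue_on \<Omega>"
  define E P S \<Phi> \<Psi> D r where "E = wgrad \<Omega> ?e" and "P = wgrad \<Omega> (ph i)" and "S = wgrad \<Omega> (ps i)"
    and "\<Phi> = wgrad \<Omega> \<phi>h" and "\<Psi> = wgrad \<Omega> \<phi>H" and "D = wgrad \<Omega> (\<lambda>x. \<phi>h x - \<phi>H x)"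
    and "r = (\<lambda>x. ph i x - pH i x)"
  note defs = this
  have mem: "ph i \<in> V" "ps i \<in> V" "\<phi>h \<in> V"
    using fine two_grid i unfolding pnp_solution_def decoupled_two_grid_solution_def by metis+
  then have e: "?e \<in> V"
    by (intro V)
  have H1: "ph i \<in> H1 \<Omega>" "ps i \<in> H1 \<Omega>" "\<phi>h \<in> H1 \<Omega>" "?e \<in> H1 \<Omega>" "(\<lambda>x. \<phi>h x - \<phi>H x) \<in> H1 \<Omega>"
    using mem e V(1) H1_diff[OF \<open>open \<Omega>\<close> _ \<phi>H] by auto
  have L2: "E \<in> L2 \<Omega>" "P \<in> L2 \<Omega>" "S \<in> L2 \<Omega>" "\<Phi> \<in> L2 \<Omega>" "\<Psi> \<in> L2 \<Omega>" "D \<in> L2 \<Omega>"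
    unfolding defs using H1 \<phi>H by (auto intro: H1_wgrad(2)[OF \<open>open \<Omega>\<close>])
  have r: "r \<in> L2 \<Omega>"
    unfolding defs by (rule L2_diff[OF H1_imp_L2[OF H1(1)] pH])
  have [measurable]: "pH i \<in> borel_measurable ?\<mu>" "E \<in> borel_measurable ?\<mu>" "\<Psi> \<in> borel_measurable ?\<mu>"
    using L2_measurable pH L2 by auto
  let ?I1 = "\<lambda>x. (q i * ph i x) *\<^sub>R \<Phi> x \<bullet> E x" and ?I2 = "\<lambda>x. (q i * pH i x) *\<^sub>R \<Psi> x \<bullet> E x"
  have int1: "integrable ?\<mu> ?I1" and eq1: "L2_inner \<Omega> P E + integral\<^sup>L ?\<mu> ?I1 = L2_inner \<Omega> (F i) ?e"
    using fine[unfolded pnp_solution_def, THEN conjunct2, THEN conjunct2, THEN conjunct1,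
        THEN bspec, OF i, THEN bspec, OF e]
    unfolding L2_inner_def defs by (simp_all only:)
  have eq2: "L2_inner \<Omega> S E = L2_inner \<Omega> (F i) ?e - integral\<^sup>L ?\<mu> ?I2"
    using two_grid[unfolded decoupled_two_grid_solution_def, THEN conjunct2, THEN conjunct2,
        THEN conjunct1, THEN bspec, OF i, THEN bspec, OF e]
    unfolding L2_inner_def defs .
  have q: "\<bar>q i\<bar> = 1"
    by (simp add: q_def)
  \<comment> \<open>The fine solution carries integrability of its drift term by definition, the
    two-grid solution does not. Here it follows from the bound on \<open>pH i\<close>; without it
    the integral could be the default value 0 and would not be additive.\<close>
  have int2: "integrable ?\<mu> ?I2"
  proof (rule Bochner_Integration.integrable_bound)
    show "integrable ?\<mu> (\<lambda>x. M * (norm (\<Psi> x) * norm (E x)))"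
      by (intro integrable_mult_right L2_norm_mult_integrable L2)
    show "AE x in ?\<mu>. norm (?I2 x) \<le> norm (M * (norm (\<Psi> x) * norm (E x)))"
      using Mp
    proof (rule AE_mp, intro AE_I2 impI)
      fix x assume "\<bar>pH i x\<bar> \<le> M"
      then have "\<bar>pH i x\<bar> * \<bar>\<Psi> x \<bullet> E x\<bar> \<le> M * (norm (\<Psi> x) * norm (E x))"
        using \<open>0 \<le> M\<close> by (intro mult_mono Cauchy_Schwarz_ineq2) auto
      then show "norm (?I2 x) \<le> norm (M * (norm (\<Psi> x) * norm (E x)))"
        using q \<open>0 \<le> M\<close> by (simp add: abs_mult)
    qed
  qed measurable
  let ?R = "\<lambda>x. M * (norm (r x) * norm (E x)) + M * (norm (D x) * norm (E x))"
  have AE: "AE x in ?\<mu>. ?I2 x - ?I1 x \<le> ?R x"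
    using M\<phi> Mp wgrad_diff_AE[OF \<open>open \<Omega>\<close> H1(3) \<phi>H]
  proof (eventually_elim)
    case (elim x)
    then have \<Phi>: "norm (\<Phi> x) \<le> M" and p: "\<bar>pH i x\<bar> \<le> M" and D: "D x = \<Phi> x - \<Psi> x"
      by (auto simp: defs)
    have "?I2 x - ?I1 x = - q i * (r x * (\<Phi> x \<bullet> E x) + pH i x * (D x \<bullet> E x))"
      by (simp add: D r_def algebra_simps inner_diff_left)
    \<comment> \<open>Since \<open>q i\<close> is 1 or -1, its sign disappears under the absolute
      value and both species are treated at once.\<close>
    also have "\<dots> \<le> \<bar>r x * (\<Phi> x \<bullet> E x) + pH i x * (D x \<bullet> E x)\<bar>"
      by (rule abs_le_D1) (simp only: abs_mult abs_minus_cancel q mult_1 order_refl)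
    also have "\<dots> \<le> \<bar>r x\<bar> * \<bar>\<Phi> x \<bullet> E x\<bar> + \<bar>pH i x\<bar> * \<bar>D x \<bullet> E x\<bar>"
      using abs_triangle_ineq[of "r x * (\<Phi> x \<bullet> E x)" "pH i x * (D x \<bullet> E x)"] by (simp only: abs_mult)
    also have "\<dots> \<le> \<bar>r x\<bar> * (M * norm (E x)) + M * (norm (D x) * norm (E x))"
    proof (rule add_mono)
      have "\<bar>\<Phi> x \<bullet> E x\<bar> \<le> M * norm (E x)"
        by (rule order_trans[OF Cauchy_Schwarz_ineq2 mult_right_mono[OF \<Phi> norm_ge_zero]])
      then show "\<bar>r x\<bar> * \<bar>\<Phi> x \<bullet> E x\<bar> \<le> \<bar>r x\<bar> * (M * norm (E x))"
        by (rule mult_left_mono) simp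
      show "\<bar>pH i x\<bar> * \<bar>D x \<bullet> E x\<bar> \<le> M * (norm (D x) * norm (E x))"
        using p \<open>0 \<le> M\<close> by (intro mult_mono Cauchy_Schwarz_ineq2) auto
    qed
    finally show ?case
      by (simp add: algebra_simps)
  qed
  have "(L2_norm \<Omega> E)\<^sup>2 = (\<integral>x. P x \<bullet> E x - S x \<bullet> E x \<partial>?\<mu>)"
    unfolding L2_norm_power2 L2_inner_def
  proof (rule integral_cong_AE)
    show "AE x in ?\<mu>. E x \<bullet> E x = P x \<bullet> E x - S x \<bullet> E x"
      using wgrad_diff_AE[OF \<open>open \<Omega>\<close> H1(1,2)]
      by eventually_elim (simp add: defs inner_diff_left)
  qed (use L2 in \<open>auto intro!: borel_measurable_integrable L2_inner_integrable\<close>)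
  \<comment> \<open>Both equations contain the same number
    \<open>L2_inner \<Omega> (F i) ?e\<close>, so subtracting them leaves only the two drift
    integrals.\<close>
  also have "\<dots> = (\<integral>x. ?I2 x - ?I1 x \<partial>?\<mu>)"
    using eq1 eq2 int1 int2 L2 by (simp add: L2_inner_integrable L2_inner_def)
  also have "\<dots> \<le> integral\<^sup>L ?\<mu> ?R"
    using AE by (intro integral_mono_AE Bochner_Integration.integrable_diff Bochner_Integration.integrable_add
        integrable_mult_right L2_norm_mult_integrable int1 int2 L2 r)
  also have "\<dots> = M * ((\<integral>x. norm (r x) * norm (E x) \<partial>?\<mu>) + (\<integral>x. norm (D x) * norm (E x) \<partial>?\<mu>))"
    using L2_norm_mult_integrable[OF r L2(1)] L2_norm_mult_integrable[OF L2(6) L2(1)]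
    by (simp add: algebra_simps)
  also have "\<dots> \<le> M * (L2_norm \<Omega> r * L2_norm \<Omega> E + L2_norm \<Omega> D * L2_norm \<Omega> E)"
    using \<open>0 \<le> M\<close> r L2 by (intro mult_left_mono add_mono L2_Cauchy_Schwarz)
  finally have "L2_norm \<Omega> E * L2_norm \<Omega> E \<le> M * (L2_norm \<Omega> r + L2_norm \<Omega> D) * L2_norm \<Omega> E"
    by (simp add: power2_eq_square algebra_simps)
  moreover have "0 \<le> M * (L2_norm \<Omega> r + L2_norm \<Omega> D)"
    using \<open>0 \<le> M\<close> by (simp add: L2_norm_nonneg)
  ultimately have "L2_norm \<Omega> E \<le> M * (L2_norm \<Omega> r + L2_norm \<Omega> D)"
    \<comment> \<open>The factor \<open>L2_norm \<Omega> E\<close> cancels only if it is nonzero;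
      otherwise the bound holds by nonnegativity of the right-hand side.\<close>
    by (cases "L2_norm \<Omega> E = 0") (use L2_norm_nonneg[of \<Omega> E] in auto)
  then show ?thesis
    by (simp add: defs)
qed

theorem theorem3p4:
  fixes \<Omega> :: "(real ^ 'd) set"
    and F :: "nat \<Rightarrow> real ^ 'd \<Rightarrow> real"
    and J :: "real set"
    and \<Gamma> :: "real \<Rightarrow> (real ^ 'd) set set"
  assumes "CARD('d) = 2 \<or> CARD('d) = 3"
    and "bounded_lipschitz_domain \<Omega>"
    and "\<forall>i\<in>{1,2,3}. F i \<in> L2 \<Omega>"
    and "quasi_uniform_triangulations \<Omega> J \<Gamma>"
    and "pnp_uniquely_solvable \<Omega> (H1_0 \<Omega>) F"
    and "\<forall>h\<in>J. pnp_uniquely_solvable \<Omega> (fe_space \<Omega> (\<Gamma> h)) F"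
  shows "\<forall>M :: real. \<exists>C>0. \<forall>h\<in>J. \<forall>H\<in>J. \<forall>ph \<phi>h pH \<phi>H ps \<phi>s.
           pnp_solution \<Omega> (fe_space \<Omega> (\<Gamma> h)) F ph \<phi>h \<and>
           pnp_solution \<Omega> (fe_space \<Omega> (\<Gamma> H)) F pH \<phi>H \<and>
           decoupled_two_grid_solution \<Omega> (fe_space \<Omega> (\<Gamma> h)) F pH \<phi>H ps \<phi>s \<and>
           \<phi>h \<in> W1inf \<Omega> \<and> W1inf_norm \<Omega> \<phi>h \<le> ereal M \<and>
           (\<forall>i\<in>{1,2}. pH i \<in> Linf \<Omega> \<and> Linf_norm \<Omega> (pH i) \<le> ereal M) \<longrightarrow>
           (\<forall>i\<in>{1,2}.
              L2_norm \<Omega> (wgrad \<Omega> (\<lambda>x. ph i x - ps i x))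
              \<le> C * (L2_norm \<Omega> (\<lambda>x. ph i x - pH i x)
                     + L2_norm \<Omega> (wgrad \<Omega> (\<lambda>x. \<phi>h x - \<phi>H x))))"
proof (intro allI)
  fix M :: real
  have "open \<Omega>"
    using assms(2) unfolding bounded_lipschitz_domain_def by (elim conjE)
  have fe: "fe_space \<Omega> \<T> \<subseteq> H1 \<Omega>" for \<T>
    using fe_spaceD(1) by (rule subsetI)
  have AE_le: "AE x in lebesgue_on \<Omega>. norm (f x) \<le> \<bar>M\<bar> + 1" if "Linf_norm \<Omega> f \<le> ereal M"
    for f :: "real ^ 'd \<Rightarrow> 'b::euclidean_space"
    using Linf_norm_AE_bound[OF that] by eventually_elim linarith
  show "\<exists>C>0. \<forall>h\<in>J. \<forall>H\<in>J. \<forall>ph \<phi>h pH \<phi>H ps \<phi>s.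
      pnp_solution \<Omega> (fe_space \<Omega> (\<Gamma> h)) F ph \<phi>h \<and>
      pnp_solution \<Omega> (fe_space \<Omega> (\<Gamma> H)) F pH \<phi>H \<and>
      decoupled_two_grid_solution \<Omega> (fe_space \<Omega> (\<Gamma> h)) F pH \<phi>H ps \<phi>s \<and>
      \<phi>h \<in> W1inf \<Omega> \<and> W1inf_norm \<Omega> \<phi>h \<le> ereal M \<and>
      (\<forall>i\<in>{1,2}. pH i \<in> Linf \<Omega> \<and> Linf_norm \<Omega> (pH i) \<le> ereal M) \<longrightarrow>
      (\<forall>i\<in>{1,2}. L2_norm \<Omega> (wgrad \<Omega> (\<lambda>x. ph i x - ps i x))
         \<le> C * (L2_norm \<Omega> (\<lambda>x. ph i x - pH i x) + L2_norm \<Omega> (wgrad \<Omega> (\<lambda>x. \<phi>h x - \<phi>H x))))"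
  \<comment> \<open>The witness depends on \<open>M\<close> alone and is fixed before the meshes,
    hence is uniform in \<open>h\<close> and \<open>H\<close>. Absolute value and added 1 make it
    positive for every real \<open>M\<close>.\<close>
  proof (intro exI[of _ "\<bar>M\<bar> + 1"] conjI ballI allI impI; (elim conjE)?)
    fix h H ph \<phi>h pH \<phi>H ps \<phi>s i
    assume fine: "pnp_solution \<Omega> (fe_space \<Omega> (\<Gamma> h)) F ph \<phi>h"
      and coarse: "pnp_solution \<Omega> (fe_space \<Omega> (\<Gamma> H)) F pH \<phi>H"
      and two_grid: "decoupled_two_grid_solution \<Omega> (fe_space \<Omega> (\<Gamma> h)) F pH \<phi>H ps \<phi>s"
      and \<phi>h: "W1inf_norm \<Omega> \<phi>h \<le> ereal M"
      and pH: "\<forall>i\<in>{1,2}. pH i \<in> Linf \<Omega> \<and> Linf_norm \<Omega> (pH i) \<le> ereal M"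
      and i: "i \<in> {1, 2::nat}"
    have "pH i \<in> H1 \<Omega>" "\<phi>H \<in> H1 \<Omega>"
      using coarse i fe unfolding pnp_solution_def by (metis subsetD)+
    then have "pH i \<in> L2 \<Omega>"
      by (intro H1_imp_L2)
    show "L2_norm \<Omega> (wgrad \<Omega> (\<lambda>x. ph i x - ps i x)) \<le> (\<bar>M\<bar> + 1) *
        (L2_norm \<Omega> (\<lambda>x. ph i x - pH i x) + L2_norm \<Omega> (wgrad \<Omega> (\<lambda>x. \<phi>h x - \<phi>H x)))"
    proof (rule decoupled_two_grid_error[OF \<open>open \<Omega>\<close> fe fe_space_diff[OF \<open>open \<Omega>\<close>] fine two_grid i])
      show "AE x in lebesgue_on \<Omega>. norm (wgrad \<Omega> \<phi>h x) \<le> \<bar>M\<bar> + 1"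
        using \<phi>h by (intro AE_le) (simp add: W1inf_norm_def)
      show "AE x in lebesgue_on \<Omega>. \<bar>pH i x\<bar> \<le> \<bar>M\<bar> + 1"
        using AE_le[of "pH i"] pH i by auto
    qed (fact | simp)+
  qed simp
qed

end
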